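(* Let $T,S\in \mathcal{B}_A(\mathcal{H})$. Then $$\omega_{A,\mathrm{e}}(T,S)\leq \sqrt{\max\big\{\omega_A(T),\omega_A(S)\big\}\,\sqrt{\|T^\sharp T+S^\sharp S\|_A+2\,\omega_A(S^\sharp T)}\,}.$$
   Context: $\mathcal{H}$ is a complex Hilbert space with inner product $\langle\cdot\mid\cdot\rangle$, $\mathcal{B}(\mathcal{H})$ is the algebra of bounded linear operators on $\mathcal{H}$, and $A\in\mathcal{B}(\mathcal{H})$ is a fixed nonzero positive (semidefinite) operator. Put $\langle x\mid y\rangle_A=\langle Ax\mid y\rangle$ and $\|x\|_A=\langle x\mid x\rangle_A^{1/2}$. $\mathcal{B}_A(\mathcal{H})=\{T\in\mathcal{B}(\mathcal{H}) : \mathcal{R}(T^*A)\subseteq\mathcal{R}(A)\}$, where $\mathcal{R}$ denotes range; for $T\in\mathcal{B}_A(\mathcal{H})$, $T^\sharp$ denotes the unique $X\in\mathcal{B}(\mathcal{H})$ with $AX=T^*A$ and $\mathcal{R}(X)\subseteq\overline{\mathcal{R}(A)}$ (so $\langle Tx\mid y\rangle_A=\langle x\mid T^\sharp y\rangle_A$). For $T,S\in\mathcal{B}_A(\mathcal{H})$: $\|T\|_A=\sup\{\|Tx\|_A : \|x\|_A=1\}$, $\omega_A(T)=\sup\{|\langle Tx\mid x\rangle_A| : \|x\|_A=1\}$, and $\omega_{A,\mathrm{e}}(T,S)=\sup\{(|\langle Tx\mid x\rangle_A|^2+|\langle Sx\mid x\rangle_A|^2)^{1/2} : \|x\|_A=1\}$.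 All of these are finite. *)

theory Defs
  imports "HOL-Analysis.Analysis"
begin

text \<open>Complex Hilbert spaces. The real inner product inherited from \<open>real_inner\<close> is the real part
  of the complex one, so that the norm is \<open>sqrt (Re (cinner x x))\<close> and positive definiteness of
  \<open>cinner\<close> is inherited. The complex inner product is linear in its first argument.\<close>

class complex_hilbert_space = real_inner + complete_space +
  fixes scaleC :: "complex \<Rightarrow> 'a \<Rightarrow> 'a"  (infixr \<open>*\<^sub>C\<close> 75)
    and cinner :: "'a \<Rightarrow> 'a \<Rightarrow> complex"
  assumes scaleC_add_right: "c *\<^sub>C (x + y) = c *\<^sub>C x + c *\<^sub>C y"
    and scaleC_add_left: "(c + d) *\<^sub>C x = c *\<^sub>C x + d *\<^sub>C x"
    and scaleC_scaleC: "c *\<^sub>C (d *\<^sub>C x) = (c * d) *\<^sub>C x"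
    and scaleC_of_real: "complex_of_real r *\<^sub>C x = r *\<^sub>R x"
    and cinner_add_left: "cinner (x + y) z = cinner x z + cinner y z"
    and cinner_scaleC_left: "cinner (c *\<^sub>C x) y = c * cinner x y"
    and cinner_commute: "cinner y x = cnj (cinner x y)"
    and Re_cinner: "Re (cinner x y) = inner x y"

definition bounded_clinear :: "('a::complex_hilbert_space \<Rightarrow> 'a) \<Rightarrow> bool" where
  "bounded_clinear T \<longleftrightarrow> bounded_linear T \<and> (\<forall>c x. T (c *\<^sub>C x) = c *\<^sub>C T x)"

definition positive_op :: "('a::complex_hilbert_space \<Rightarrow> 'a) \<Rightarrow> bool" where
  "positive_op A \<longleftrightarrow> bounded_clinear A \<and>
     (\<forall>x. Im (cinner (A x) x) = 0 \<and> Re (cinner (A x) x) \<ge> 0)"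

definition cadjoint :: "('a::complex_hilbert_space \<Rightarrow> 'a) \<Rightarrow> 'a \<Rightarrow> 'a" where
  "cadjoint T = (THE T'. bounded_clinear T' \<and> (\<forall>x y. cinner (T x) y = cinner x (T' y)))"

definition A_inner :: "('a::complex_hilbert_space \<Rightarrow> 'a) \<Rightarrow> 'a \<Rightarrow> 'a \<Rightarrow> complex" where
  "A_inner A x y = cinner (A x) y"

definition A_norm :: "('a::complex_hilbert_space \<Rightarrow> 'a) \<Rightarrow> 'a \<Rightarrow> real" where
  "A_norm A x = sqrt (Re (A_inner A x x))"

definition B_A :: "('a::complex_hilbert_space \<Rightarrow> 'a) \<Rightarrow> ('a \<Rightarrow> 'a) set" where
  "B_A A = {T. bounded_clinear T \<and> range (cadjoint T \<circ> A) \<subseteq> range A}"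

text \<open>For positive \<open>A\<close> and \<open>T \<in> B_A A\<close>, such an \<open>X\<close> exists by Douglas' range inclusion theorem; it
  is unique because \<open>A\<close> is injective on the closure of its range.\<close>

definition A_sharp :: "('a::complex_hilbert_space \<Rightarrow> 'a) \<Rightarrow> ('a \<Rightarrow> 'a) \<Rightarrow> 'a \<Rightarrow> 'a" where
  "A_sharp A T = (THE X. bounded_clinear X \<and> A \<circ> X = cadjoint T \<circ> A \<and>
     range X \<subseteq> closure (range A))"

text \<open>The suprema below are real-valued, hence meaningful only for nonempty bounded sets; this is the
  case for nonzero positive \<open>A\<close> and operators in \<open>B_A A\<close>.\<close>

definition A_opnorm :: "('a::complex_hilbert_space \<Rightarrow> 'a) \<Rightarrow> ('a \<Rightarrow> 'a) \<Rightarrow> real" where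
  "A_opnorm A T = (SUP x\<in>{x. A_norm A x = 1}. A_norm A (T x))"

definition A_numradius :: "('a::complex_hilbert_space \<Rightarrow> 'a) \<Rightarrow> ('a \<Rightarrow> 'a) \<Rightarrow> real" where
  "A_numradius A T = (SUP x\<in>{x. A_norm A x = 1}. cmod (A_inner A (T x) x))"

definition A_euclidean_radius ::
    "('a::complex_hilbert_space \<Rightarrow> 'a) \<Rightarrow> ('a \<Rightarrow> 'a) \<Rightarrow> ('a \<Rightarrow> 'a) \<Rightarrow> real" where
  "A_euclidean_radius A T S =
     (SUP x\<in>{x. A_norm A x = 1}.
        sqrt ((cmod (A_inner A (T x) x))\<^sup>2 + (cmod (A_inner A (S x) x))\<^sup>2))"

end

theory Submission imports Defs begin

text \<open>For \<open>x\<close> of \<open>A\<close>-norm 1 put \<open>a = \<langle>Tx|x\<rangle>\<^sub>A\<close>, \<open>b = \<langle>Sx|x\<rangle>\<^sub>A\<close> and \<open>y = cnj a Tx + cnj b Sx\<close>. Then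
  \<open>|a|\<^sup>2 + |b|\<^sup>2 = \<langle>y|x\<rangle>\<^sub>A\<close> is at most the \<open>A\<close>-norm of \<open>y\<close>; expanding the square of the latter and
  bounding \<open>|a|\<close>, \<open>|b|\<close> by the numerical radii gives the inequality pointwise. Passing to suprema
  requires that \<open>T\<^sup>\<sharp>\<close> exists (Douglas) and that \<open>T\<close>, \<open>T\<^sup>\<sharp>T\<close> are bounded for the \<open>A\<close>-seminorm (Krein--Lax):
  every \<open>A\<close>-selfadjoint bounded operator has \<open>A\<close>-norm at most its ordinary norm.\<close>

section \<open>Projection, Riesz representation and a boundedness criterion\<close>

text \<open>For \<open>c > 0\<close> evaluate at the minimiser \<open>t = - b / c\<close>. The
  degenerate case \<open>c = 0\<close> is included because the \<open>A\<close>-seminorm can vanish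
  on nonzero vectors.\<close>

lemma quadratic_nonneg_imp_discriminant:
  fixes a b c :: real
  assumes "c \<ge> 0" and nonneg: "\<And>t. a + 2 * b * t + c * t\<^sup>2 \<ge> 0"
  shows "b\<^sup>2 \<le> a * c"
proof (cases "c = 0")
  case True
  have "b = 0"
  proof (rule ccontr)
    assume "b \<noteq> 0"
    \<comment> \<open>With \<open>c = 0\<close> the expression is affine in \<open>t\<close>; the
      chosen point gives it the value -1.\<close>
    then show False
      using nonneg[of "- (a + 1) / (2 * b)"] True by (simp add: field_simps)
  qed
  then show ?thesis using True by simp
next
  case False
  then have "c > 0" using assms(1) by simp
  have "a + 2 * b * (- b / c) + c * (- b / c)\<^sup>2 = a - b\<^sup>2 / c"
    using False by (simp add: field_simps power2_eq_square)
  then have "b\<^sup>2 / c \<le> a" using nonneg[of "- b / c"] by simp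
  then show ?thesis using \<open>c > 0\<close> by (simp add: field_simps)
qed

lemma subspace_closure:
  fixes S :: "'a::real_normed_vector set"
  assumes S: "subspace S"
  shows "subspace (closure S)"
proof (rule subspaceI)
  show "0 \<in> closure S" using subspace_0[OF S] closure_subset by blast
next
  fix x y assume "x \<in> closure S" "y \<in> closure S"
  then obtain f g where "\<And>n. f n \<in> S" "f \<longlonglongrightarrow> x" "\<And>n. g n \<in> S" "g \<longlonglongrightarrow> y"
    unfolding closure_sequential by blast
  then have "\<And>n. f n + g n \<in> S" "(\<lambda>n. f n + g n) \<longlonglongrightarrow> x + y"
    by (auto intro: subspace_add[OF S] tendsto_add)
  then show "x + y \<in> closure S"
    unfolding closure_sequential by (intro exI[of _ "\<lambda>n. f n + g n"]) blast
next
  fix c :: real and x assume "x \<in> closure S"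
  then obtain f where "\<And>n. f n \<in> S" "f \<longlonglongrightarrow> x"
    unfolding closure_sequential by blast
  then have "\<And>n. c *\<^sub>R f n \<in> S" "(\<lambda>n. c *\<^sub>R f n) \<longlonglongrightarrow> c *\<^sub>R x"
    by (auto intro: subspace_mul[OF S] tendsto_intros)
  then show "c *\<^sub>R x \<in> closure S"
    unfolding closure_sequential by (intro exI[of _ "\<lambda>n. c *\<^sub>R f n"]) blast
qed

text \<open>A minimising sequence for the distance to \<open>V\<close> converges by the
  parallelogram law, and minimality of the limit gives orthogonality.\<close>

lemma closed_subspace_projection:
  fixes V :: "'a::{real_inner,complete_space} set"
  assumes V: "subspace V" "closed V"
  obtains p where "p \<in> V" "\<And>v. v \<in> V \<Longrightarrow> inner (x - p) v = 0"
proof -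
  define d where "d = (INF v\<in>V. (norm (x - v))\<^sup>2)"
  have "V \<noteq> {}" using V subspace_0 by blast
  have bdd: "bdd_below ((\<lambda>v. (norm (x - v))\<^sup>2) ` V)"
    by (rule bdd_belowI[of _ 0]) auto
  have d_le: "d \<le> (norm (x - v))\<^sup>2" if "v \<in> V" for v
    unfolding d_def using bdd that by (rule cINF_lower)
  have "\<exists>v\<in>V. (norm (x - v))\<^sup>2 < d + inverse (Suc n)" for n
    using cINF_less_iff[OF \<open>V \<noteq> {}\<close> bdd, of "d + inverse (Suc n)"] unfolding d_def by simp
  then obtain v where vV: "\<And>n. v n \<in> V"
    and v: "\<And>n. (norm (x - v n))\<^sup>2 < d + inverse (Suc n)" by metis
  \<comment> \<open>Parallelogram identity for \<open>x - v m\<close> and \<open>x - v n\<close>: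
    the midpoint lies in \<open>V\<close>, so its squared distance from \<open>x\<close> is at least
    \<open>d\<close>.\<close>
  have gap: "(norm (v m - v n))\<^sup>2 \<le> 2 * inverse (Suc m) + 2 * inverse (Suc n)" for m n
  proof -
    have "(1 / 2) *\<^sub>R (v m + v n) \<in> V"
      using V vV by (simp add: subspace_add subspace_mul)
    then have "d \<le> (norm (x - (1 / 2) *\<^sub>R (v m + v n)))\<^sup>2" by (rule d_le)
    moreover have "(norm (v m - v n))\<^sup>2 = 2 * (norm (x - v m))\<^sup>2 + 2 * (norm (x - v n))\<^sup>2
        - 4 * (norm (x - (1 / 2) *\<^sub>R (v m + v n)))\<^sup>2"
      by (simp add: power2_norm_eq_inner algebra_simps inner_commute)
    ultimately show ?thesis using v[of m] v[of n] by linarith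
  qed
  have "Cauchy v"
  proof (rule metric_CauchyI)
    fix e :: real assume "e > 0"
    then obtain N where N: "inverse (real (Suc N)) < e\<^sup>2 / 4"
      using reals_Archimedean[of "e\<^sup>2 / 4"] by auto
    have "dist (v m) (v n) < e" if "m \<ge> N" "n \<ge> N" for m n
    proof -
      have "inverse (real (Suc m)) \<le> inverse (real (Suc N))"
        "inverse (real (Suc n)) \<le> inverse (real (Suc N))"
        using that by (auto intro!: le_imp_inverse_le)
      then have "(norm (v m - v n))\<^sup>2 < e\<^sup>2" using gap[of m n] N by linarith
      then show ?thesis using \<open>e > 0\<close> by (simp add: dist_norm power2_less_imp_less)
    qed
    then show "\<exists>M. \<forall>m\<ge>M. \<forall>n\<ge>M. dist (v m) (v n) < e" by blast
  qed
  then obtain p where p: "v \<longlonglongrightarrow> p"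
    using Cauchy_convergent convergent_def by blast
  have "p \<in> V" using closed_sequentially[OF V(2)] vV p by blast
  have "(norm (x - p))\<^sup>2 \<le> d"
  proof (rule LIMSEQ_le)
    show "(\<lambda>n. (norm (x - v n))\<^sup>2) \<longlonglongrightarrow> (norm (x - p))\<^sup>2" by (intro tendsto_intros p)
    show "(\<lambda>n. d + inverse (Suc n)) \<longlonglongrightarrow> d"
      using tendsto_add[OF tendsto_const LIMSEQ_inverse_real_of_nat, of d] by simp
    show "\<exists>N. \<forall>n\<ge>N. (norm (x - v n))\<^sup>2 \<le> d + inverse (Suc n)"
      using v less_imp_le by blast
  qed
  have "inner (x - p) w = 0" if "w \<in> V" for w
  proof -
    \<comment> \<open>Moving from \<open>p\<close> by \<open>t *\<^sub>R w\<close> does not decrease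
      the distance to \<open>x\<close>. The constant term is 0, so the discriminant bound forces the
      linear coefficient to vanish.\<close>
    have "0 + 2 * (- inner (x - p) w) * t + (norm w)\<^sup>2 * t\<^sup>2 \<ge> 0" for t
    proof -
      have "p + t *\<^sub>R w \<in> V" using V \<open>p \<in> V\<close> that by (simp add: subspace_add subspace_mul)
      then have "(norm (x - p))\<^sup>2 \<le> (norm (x - (p + t *\<^sub>R w)))\<^sup>2"
        using d_le \<open>(norm (x - p))\<^sup>2 \<le> d\<close> order_trans by blast
      then show ?thesis
        by (simp add: power2_norm_eq_inner algebra_simps inner_commute power2_eq_square[of t])
    qed
    from quadratic_nonneg_imp_discriminant[OF _ this] show ?thesis by simp
  qed
  with \<open>p \<in> V\<close> show thesis by (rule that)
qed

lemma riesz_representation: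
  fixes f :: "'a::{real_inner,complete_space} \<Rightarrow> real"
  assumes "bounded_linear f"
  obtains y where "\<And>x. f x = inner x y"
proof (cases "\<forall>x. f x = 0")
  case True
  then show thesis using that[of 0] by simp
next
  case False
  interpret bounded_linear f by fact
  obtain x0 where x0: "f x0 \<noteq> 0" using False by blast
  have "closed (f -` {0})"
    by (intro closed_vimage closed_singleton) (simp add: continuous_on)
  then have cl: "closed {x. f x = 0}" by (simp add: vimage_def)
  have sub: "subspace {x. f x = 0}" by (auto simp: subspace_def add scaleR zero)
  obtain p where p: "f p = 0" and orth: "\<And>v. f v = 0 \<Longrightarrow> inner (x0 - p) v = 0"
    using closed_subspace_projection[OF sub cl, of x0] by auto
  define z where "z = x0 - p"
  have fz: "f z \<noteq> 0" using x0 p by (simp add: z_def diff)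
  then have z: "inner z z \<noteq> 0" using zero by auto
  have "f x = inner x ((f z / inner z z) *\<^sub>R z)" for x
  proof -
    \<comment> \<open>Subtracting this multiple of \<open>z\<close> projects \<open>x\<close> into
      the kernel of \<open>f\<close>, to which \<open>z\<close> is orthogonal.\<close>
    have "f (x - (f x / f z) *\<^sub>R z) = 0" using fz by (simp add: diff scaleR)
    then have "inner z (x - (f x / f z) *\<^sub>R z) = 0" unfolding z_def by (rule orth)
    then show ?thesis using fz z
      by (simp add: inner_diff_right inner_commute field_simps)
  qed
  then show thesis by (rule that)
qed

text \<open>Uniform boundedness, in a form that replaces the closed graph theorem: since \<open>X\<close> takes values in
  the closure of \<open>D\<close>, the set where \<open>norm (X x) \<le> n\<close> is cut out by closed conditions.\<close>

lemma bounded_linear_if_weakly_continuous: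
  fixes X :: "'a::{real_normed_vector,complete_space} \<Rightarrow> 'b::real_inner"
  assumes "linear X" and dense: "\<And>x. X x \<in> closure D"
    and cont: "\<And>d. d \<in> D \<Longrightarrow> continuous_on UNIV (\<lambda>x. inner (X x) d)"
  shows "bounded_linear X"
proof -
  interpret linear X by fact
  define F where "F n = {x. \<forall>d\<in>D. inner (X x) d \<le> real n * norm d}" for n
  have norm_le: "norm (X x) \<le> real n" if "x \<in> F n" for x n
  proof -
    have "closed {u. inner (X x) u \<le> real n * norm u}"
      by (intro closed_Collect_le continuous_intros)
    moreover have "D \<subseteq> {u. inner (X x) u \<le> real n * norm u}" using that by (auto simp: F_def)
    ultimately have "closure D \<subseteq> {u. inner (X x) u \<le> real n * norm u}"
      by (rule closure_minimal[rotated])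
    \<comment> \<open>The inequality extends from \<open>D\<close> to its closure, so it may be
      tested at \<open>X x\<close> itself.\<close>
    then have "inner (X x) (X x) \<le> real n * norm (X x)" using dense[of x] by blast
    then have "norm (X x) * norm (X x) \<le> real n * norm (X x)"
      by (simp add: norm_eq_sqrt_inner flip: power2_eq_square)
    then show ?thesis by (cases "X x = 0") auto
  qed
  have "closed (F n)" for n
  proof -
    have "F n = (\<Inter>d\<in>D. {x. inner (X x) d \<le> real n * norm d})" by (auto simp: F_def)
    moreover have "closed (\<Inter>d\<in>D. {x. inner (X x) d \<le> real n * norm d})"
      by (intro closed_INT ballI closed_Collect_le cont continuous_intros)
    ultimately show ?thesis by simp
  qed
  moreover have "(\<Union>n. F n) = UNIV"
  proof -
    have "\<exists>n. x \<in> F n" for x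
    proof -
      obtain n where n: "norm (X x) \<le> real n" using real_arch_simple by blast
      have "inner (X x) d \<le> real n * norm d" for d
        using norm_cauchy_schwarz[of "X x" d] mult_right_mono[OF n, of "norm d"] by simp
      then show ?thesis by (auto simp: F_def)
    qed
    then show ?thesis by blast
  qed
  \<comment> \<open>Baire: countably many closed sets cover a complete space, so one of them has an
    interior point.\<close>
  ultimately have "\<exists>n. interior (F n) \<noteq> {}"
    using Baire_category_alt[of "euclidean :: 'a topology" "range F"]
      completely_metrizable_space_euclidean
    by (fastforce simp: closed_closedin[symmetric])
  then obtain n a where "a \<in> interior (F n)" by blast
  then obtain r where r: "r > 0" "ball a r \<subseteq> F n"
    by (meson mem_interior)
  \<comment> \<open>Linearity carries the bound from the ball around \<open>a\<close> to a ball
    around 0, at the cost of a factor 2.\<close>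
  have small: "norm (X h) \<le> 2 * real n" if "norm h < r" for h
  proof -
    have "a + h \<in> F n" "a \<in> F n" using r that by (auto simp: dist_norm subset_eq)
    then have "norm (X (a + h)) \<le> real n" "norm (X a) \<le> real n" by (auto intro: norm_le)
    moreover have "X h = X (a + h) - X a" by (simp add: add)
    ultimately show ?thesis using norm_triangle_ineq4[of "X (a + h)" "X a"] by simp
  qed
  have "norm (X x) \<le> norm x * (4 * real n / r)" for x
  proof (cases "x = 0")
    case False
    \<comment> \<open>Rescaling \<open>x\<close> to norm \<open>r / 2\<close> gives the second
      factor 2 in the constant \<open>4 * real n / r\<close>.\<close>
    have "norm ((r / (2 * norm x)) *\<^sub>R x) < r" using r False by simp
    then have "r / (2 * norm x) * norm (X x) \<le> 2 * real n"
      using small[of "(r / (2 * norm x)) *\<^sub>R x"] r by (simp add: scale)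
    then show ?thesis using False r by (simp add: field_simps)
  qed (simp add: zero)
  then show ?thesis
    by (intro bounded_linear_intro[of X "4 * real n / r"] add scale)
qed

section \<open>The complex inner product and adjoints\<close>

lemma cinner_add_right: "cinner x (y + z) = cinner x y + cinner x z"
  by (metis cinner_add_left cinner_commute complex_cnj_add)

lemma cinner_scaleC_right: "cinner x (c *\<^sub>C y) = cnj c * cinner x y"
  by (metis cinner_commute cinner_scaleC_left complex_cnj_mult)

lemma cinner_scaleR_right: "cinner x (r *\<^sub>R y) = of_real r * cinner x y"
  by (metis cinner_scaleC_right scaleC_of_real complex_cnj_complex_of_real)

lemma cinner_diff_right: "cinner x (y - z) = cinner x y - cinner x z"
  by (metis add_diff_cancel_right' cinner_add_right diff_add_cancel)

text \<open>Together with \<open>Re_cinner\<close> this recovers the complex inner product from the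
  real one, so real Riesz representation suffices for complex adjoints.\<close>

lemma Im_cinner: "Im (cinner x y) = - inner (\<i> *\<^sub>C x) y"
  by (simp add: cinner_scaleC_left flip: Re_cinner)

lemma cinner_self_eq_0: "cinner x x = 0 \<Longrightarrow> x = 0"
  by (metis Re_cinner inner_eq_zero_iff zero_complex.simps(1))

lemma cinner_right_eqI: "(\<And>z. cinner z x = cinner z y) \<Longrightarrow> x = y"
  by (metis cinner_diff_right cinner_self_eq_0 eq_iff_diff_eq_0)

lemma norm_scaleC: "norm (c *\<^sub>C x) = cmod c * norm x"
proof -
  have "cinner (c *\<^sub>C x) (c *\<^sub>C x) = of_real ((cmod c)\<^sup>2) * cinner x x"
    unfolding complex_norm_square by (simp add: cinner_scaleC_left cinner_scaleC_right)
  then have "inner (c *\<^sub>C x) (c *\<^sub>C x) = (cmod c)\<^sup>2 * inner x x"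
    by (simp only: Re_complex_of_real Im_complex_of_real times_complex.sel mult_zero_left diff_0_right
        flip: Re_cinner)
  then show ?thesis by (simp add: norm_eq_sqrt_inner real_sqrt_mult)
qed

lemma bounded_linear_scaleC: "bounded_linear (\<lambda>x. c *\<^sub>C x)"
proof (rule bounded_linear_intro)
  show "c *\<^sub>C (r *\<^sub>R x) = r *\<^sub>R (c *\<^sub>C x)" for r x
    by (simp add: scaleC_scaleC mult.commute flip: scaleC_of_real)
  show "norm (c *\<^sub>C x) \<le> norm x * cmod c" for x by (simp add: norm_scaleC mult.commute)
qed (rule scaleC_add_right)

lemma bounded_clinear_add: "bounded_clinear T \<Longrightarrow> T (x + y) = T x + T y"
  by (simp add: bounded_clinear_def bounded_linear.axioms(1) linear_add)

lemma bounded_clinear_diff: "bounded_clinear T \<Longrightarrow> T (x - y) = T x - T y"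
  by (simp add: bounded_clinear_def bounded_linear.axioms(1) linear_diff)

lemma bounded_clinear_scaleC: "bounded_clinear T \<Longrightarrow> T (c *\<^sub>C x) = c *\<^sub>C T x"
  by (simp add: bounded_clinear_def)

lemma bounded_clinear_scaleR: "bounded_clinear T \<Longrightarrow> T (r *\<^sub>R x) = r *\<^sub>R T x"
  by (simp add: bounded_clinear_def bounded_linear.axioms(1) linear_scale)

lemma bounded_clinear_compose:
  "bounded_clinear T \<Longrightarrow> bounded_clinear S \<Longrightarrow> bounded_clinear (T \<circ> S)"
  by (auto simp: bounded_clinear_def comp_def intro: bounded_linear_compose)

lemma cadjoint_exists:
  fixes T :: "'a::complex_hilbert_space \<Rightarrow> 'a"
  assumes T: "bounded_clinear T"
  obtains T' where "bounded_clinear T'" "\<And>x y. cinner (T x) y = cinner x (T' y)"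
proof -
  have bl: "bounded_linear T" using T by (simp add: bounded_clinear_def)
  have "\<exists>w. \<forall>x. inner (T x) y = inner x w" for y
  proof -
    have "bounded_linear (\<lambda>x. inner (T x) y)"
      using bounded_linear_compose[OF bounded_linear_inner_left bl] .
    then show ?thesis by (metis riesz_representation)
  qed
  then obtain T' where T': "\<And>x y. inner (T x) y = inner x (T' y)" by metis
  \<comment> \<open>The imaginary parts agree by applying the real identity to
    \<open>\<i> *\<^sub>C x\<close>, using complex linearity of \<open>T\<close>.\<close>
  have adj: "cinner (T x) y = cinner x (T' y)" for x y
    by (intro complex_eqI)
      (simp_all add: Re_cinner Im_cinner T' flip: bounded_clinear_scaleC[OF T])
  have add: "T' (x + y) = T' x + T' y" for x y
    by (rule cinner_right_eqI) (simp add: cinner_add_right flip: adj)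
  have scaleC: "T' (c *\<^sub>C x) = c *\<^sub>C T' x" for c x
    by (rule cinner_right_eqI) (simp add: cinner_scaleC_right flip: adj)
  \<comment> \<open>Testing the adjoint identity at \<open>T' y\<close> gives the bound after
    cancelling one factor \<open>norm (T' y)\<close>.\<close>
  have "norm (T' y) \<le> norm y * onorm T" for y
  proof -
    have "(norm (T' y))\<^sup>2 = inner (T (T' y)) y" by (simp add: T' power2_norm_eq_inner)
    also have "\<dots> \<le> norm (T (T' y)) * norm y" by (rule norm_cauchy_schwarz)
    also have "\<dots> \<le> onorm T * norm (T' y) * norm y"
      by (intro mult_right_mono onorm bl) simp
    finally have "norm (T' y) * norm (T' y) \<le> (norm y * onorm T) * norm (T' y)"
      by (simp add: power2_eq_square mult_ac)
    then show ?thesis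
      by (cases "T' y = 0") (auto intro: mult_nonneg_nonneg onorm_pos_le[OF bl])
  qed
  then have "bounded_linear T'"
    by (intro bounded_linear_intro[of _ "onorm T"])
      (auto simp: add scaleC simp flip: scaleC_of_real)
  then have "bounded_clinear T'" by (simp add: bounded_clinear_def scaleC)
  with adj show thesis by (rule that[rotated])
qed

lemma
  fixes T :: "'a::complex_hilbert_space \<Rightarrow> 'a"
  assumes "bounded_clinear T"
  shows bounded_clinear_cadjoint: "bounded_clinear (cadjoint T)"
    and cinner_cadjoint: "cinner (T x) y = cinner x (cadjoint T y)"
proof -
  let ?P = "\<lambda>T'. bounded_clinear T' \<and> (\<forall>x y. cinner (T x) y = cinner x (T' y))"
  have "\<exists>!T'. ?P T'"
  proof (rule ex_ex1I)
    show "\<exists>T'. ?P T'" using cadjoint_exists[OF assms] by metis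
    show "T1 = T2" if "?P T1" "?P T2" for T1 T2
      using that by (intro ext cinner_right_eqI) metis
  qed
  then have "?P (cadjoint T)" unfolding cadjoint_def by (rule theI')
  then show "bounded_clinear (cadjoint T)" "cinner (T x) y = cinner x (cadjoint T y)"
    by blast+
qed

section \<open>The semi-inner product of a positive operator\<close>

locale positive_operator =
  fixes A :: "'a::complex_hilbert_space \<Rightarrow> 'a"
  assumes positive_op: "positive_op A"
begin

lemma A_bounded_clinear: "bounded_clinear A"
  using positive_op by (simp add: positive_op_def)

lemma Im_A_inner_self: "Im (A_inner A x x) = 0"
  using positive_op by (simp add: positive_op_def A_inner_def)

lemma Re_A_inner_self_nonneg: "Re (A_inner A x x) \<ge> 0"
  using positive_op by (simp add: positive_op_def A_inner_def)

lemma A_inner_add_left: "A_inner A (x + y) z = A_inner A x z + A_inner A y z"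
  by (simp add: A_inner_def bounded_clinear_add[OF A_bounded_clinear] cinner_add_left)

lemma A_inner_add_right: "A_inner A x (y + z) = A_inner A x y + A_inner A x z"
  by (simp add: A_inner_def cinner_add_right)

lemma A_inner_scaleC_left: "A_inner A (c *\<^sub>C x) y = c * A_inner A x y"
  by (simp add: A_inner_def bounded_clinear_scaleC[OF A_bounded_clinear] cinner_scaleC_left)

lemma A_inner_scaleC_right: "A_inner A x (c *\<^sub>C y) = cnj c * A_inner A x y"
  by (simp add: A_inner_def cinner_scaleC_right)

lemma A_inner_scaleR_left: "A_inner A (r *\<^sub>R x) y = of_real r * A_inner A x y"
  by (metis A_inner_scaleC_left scaleC_of_real)

lemma A_inner_scaleR_right: "A_inner A x (r *\<^sub>R y) = of_real r * A_inner A x y"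
  by (simp add: A_inner_def cinner_scaleR_right)

text \<open>Polarization: the quadratic form is real at \<open>x + y\<close> and at \<open>x + \<i> y\<close>.\<close>

lemma A_inner_commute: "A_inner A y x = cnj (A_inner A x y)"
proof (rule complex_eqI)
  show "Re (A_inner A y x) = Re (cnj (A_inner A x y))"
    using Im_A_inner_self[of "x + \<i> *\<^sub>C y"] Im_A_inner_self[of x] Im_A_inner_self[of y]
    by (simp add: A_inner_add_left A_inner_add_right A_inner_scaleC_left A_inner_scaleC_right)
  show "Im (A_inner A y x) = Im (cnj (A_inner A x y))"
    using Im_A_inner_self[of "x + y"] Im_A_inner_self[of x] Im_A_inner_self[of y]
    by (simp add: A_inner_add_left A_inner_add_right)
qed

lemma A_symmetric: "cinner (A x) y = cinner x (A y)"
  using A_inner_commute[of x y] by (simp add: A_inner_def flip: cinner_commute)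

lemma A_norm_nonneg: "A_norm A x \<ge> 0"
  by (simp add: A_norm_def Re_A_inner_self_nonneg)

lemma A_norm_power2: "(A_norm A x)\<^sup>2 = Re (A_inner A x x)"
  by (simp add: A_norm_def Re_A_inner_self_nonneg)

lemma A_inner_self: "A_inner A x x = of_real ((A_norm A x)\<^sup>2)"
  by (rule complex_eqI) (simp_all add: A_norm_power2 Im_A_inner_self)

lemma A_norm_scaleR: "A_norm A (r *\<^sub>R x) = \<bar>r\<bar> * A_norm A x"
  by (simp add: A_norm_def A_inner_scaleR_left A_inner_scaleR_right real_sqrt_mult
      flip: mult.assoc)

text \<open>The discriminant bound for the nonnegative quadratic in \<open>t\<close> given by the
  squared seminorm of \<open>x + t *\<^sub>R y\<close>.\<close>

lemma Re_A_inner_le: "Re (A_inner A x y) \<le> A_norm A x * A_norm A y"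
proof -
  have "(A_norm A x)\<^sup>2 + 2 * Re (A_inner A x y) * t + (A_norm A y)\<^sup>2 * t\<^sup>2 \<ge> 0" for t
    using Re_A_inner_self_nonneg[of "x + t *\<^sub>R y"] A_inner_commute[of x y]
    by (simp add: A_norm_power2 A_inner_add_left A_inner_add_right A_inner_scaleR_left
        A_inner_scaleR_right power2_eq_square[of t] algebra_simps)
  then have "(Re (A_inner A x y))\<^sup>2 \<le> (A_norm A x * A_norm A y)\<^sup>2"
    using quadratic_nonneg_imp_discriminant[of "(A_norm A y)\<^sup>2"]
    by (simp add: power_mult_distrib)
  then show ?thesis
    by (rule power2_le_imp_le) (simp add: A_norm_nonneg)
qed

lemma A_Cauchy_Schwarz: "cmod (A_inner A x y) \<le> A_norm A x * A_norm A y"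
proof -
  \<comment> \<open>A unimodular factor that rotates the semi-inner product onto the nonnegative
    real axis, reducing the claim to its real part.\<close>
  define c where "c = cnj (sgn (A_inner A x y))"
  show ?thesis
  proof (cases "A_inner A x y = 0")
    case False
    have c: "c * A_inner A x y = of_real (cmod (A_inner A x y))"
      using False complex_norm_square[of "A_inner A x y"]
      by (simp add: c_def sgn_eq field_simps power2_eq_square)
    have "cmod c = 1" using False by (simp add: c_def norm_sgn)
    then have "c * cnj c = 1" using complex_norm_square[of c] by simp
    then have "A_inner A (c *\<^sub>C x) (c *\<^sub>C x) = A_inner A x x"
      by (metis A_inner_scaleC_left A_inner_scaleC_right mult.assoc mult_1)
    then have "A_norm A (c *\<^sub>C x) = A_norm A x" by (simp add: A_norm_def)
    then show ?thesis
      using Re_A_inner_le[of "c *\<^sub>C x" y] by (simp add: A_inner_scaleC_left c)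
  qed (simp add: A_norm_nonneg)
qed

lemma A_norm_triangle: "A_norm A (x + y) \<le> A_norm A x + A_norm A y"
proof (rule power2_le_imp_le)
  show "(A_norm A (x + y))\<^sup>2 \<le> (A_norm A x + A_norm A y)\<^sup>2"
    using Re_A_inner_le[of x y] A_inner_commute[of x y]
    by (simp add: power2_sum A_norm_power2 A_inner_add_left A_inner_add_right)
qed (simp add: A_norm_nonneg)

lemma A_norm_le_norm: "A_norm A x \<le> sqrt (onorm A) * norm x"
proof -
  have bl: "bounded_linear A" using A_bounded_clinear by (simp add: bounded_clinear_def)
  have "Re (A_inner A x x) \<le> norm (A x) * norm x"
    by (simp add: A_inner_def Re_cinner norm_cauchy_schwarz)
  also have "\<dots> \<le> onorm A * norm x * norm x"
    by (intro mult_right_mono onorm bl) simp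
  finally have "A_norm A x \<le> sqrt (onorm A * (norm x)\<^sup>2)"
    by (simp add: A_norm_def power2_eq_square mult.assoc)
  then show ?thesis by (simp add: real_sqrt_mult)
qed

text \<open>Makes the index set of the suprema nonempty.\<close>

lemma ex_A_norm_eq_1:
  assumes "A \<noteq> (\<lambda>x. 0)"
  shows "\<exists>x. A_norm A x = 1"
proof -
  obtain x where x: "A x \<noteq> 0" using assms by fastforce
  have "A_norm A x \<noteq> 0"
  proof
    assume "A_norm A x = 0"
    \<comment> \<open>Cauchy-Schwarz against \<open>A x\<close>: a vector of seminorm 0 lies in the
      kernel of \<open>A\<close>.\<close>
    then have "cinner (A x) (A x) = 0"
      using A_Cauchy_Schwarz[of x "A x"] by (simp add: A_inner_def)
    then show False using x cinner_self_eq_0 by blast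
  qed
  then have "A_norm A ((1 / A_norm A x) *\<^sub>R x) = 1"
    by (simp add: A_norm_scaleR A_norm_nonneg)
  then show ?thesis by blast
qed

text \<open>The bound comes from iterating \<open>(A_norm A (R\<^sup>n x))\<^sup>2 \<le> A_norm A (R\<^bsup>2n\<^esup> x)\<close> along powers of two and comparing
  with the growth of the ordinary norm of \<open>R\<^sup>n x\<close>.\<close>

lemma A_norm_selfadjoint_le:
  assumes R: "bounded_clinear R" and sa: "\<And>x y. A_inner A (R x) y = A_inner A x (R y)"
    and K: "K > 0" "\<And>x. norm (R x) \<le> K * norm x"
    and x: "A_norm A x = 1"
  shows "A_norm A (R x) \<le> K"
proof (rule ccontr)
  assume "\<not> A_norm A (R x) \<le> K"
  define p where "p n = A_norm A ((R ^^ n) x)" for n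
  have shift: "A_inner A ((R ^^ n) u) v = A_inner A u ((R ^^ n) v)" for n u v
    by (induction n arbitrary: v) (simp_all add: sa, simp add: funpow_swap1)
  \<comment> \<open>Selfadjointness moves one copy of \<open>R ^^ n\<close> to the other side;
    Cauchy-Schwarz then applies with \<open>A_norm A x = 1\<close>.\<close>
  have double: "(p n)\<^sup>2 \<le> p (2 * n)" for n
  proof -
    have "(p n)\<^sup>2 = Re (A_inner A x ((R ^^ (2 * n)) x))"
      by (simp add: p_def A_norm_power2 shift mult_2 funpow_add)
    also have "\<dots> \<le> p (2 * n)" using Re_A_inner_le[of x] x by (simp add: p_def)
    finally show ?thesis .
  qed
  have lower: "(p 1) ^ (2 ^ k) \<le> p (2 ^ k)" for k
  proof (induction k)
    case (Suc k)
    have "(p 1) ^ (2 ^ Suc k) = ((p 1) ^ (2 ^ k))\<^sup>2" by (simp add: mult.commute flip: power_mult)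
    also have "\<dots> \<le> (p (2 ^ k))\<^sup>2"
      using Suc by (intro power_mono) (simp_all add: p_def A_norm_nonneg)
    also have "\<dots> \<le> p (2 ^ Suc k)" using double[of "2 ^ k"] by simp
    finally show ?case .
  qed simp
  have growth: "norm ((R ^^ n) x) \<le> K ^ n * norm x" for n
  proof (induction n)
    case (Suc n)
    have "norm ((R ^^ Suc n) x) \<le> K * norm ((R ^^ n) x)" using K by simp
    also have "\<dots> \<le> K * (K ^ n * norm x)" using Suc K by (intro mult_left_mono) auto
    finally show ?case by simp
  qed simp
  define C where "C = sqrt (onorm A) * norm x"
  have upper: "p n \<le> C * K ^ n" for n
  proof -
    have "bounded_linear A" using A_bounded_clinear by (simp add: bounded_clinear_def)
    then have "sqrt (onorm A) * norm ((R ^^ n) x) \<le> sqrt (onorm A) * (K ^ n * norm x)"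
      using growth[of n] by (intro mult_left_mono) (auto simp: onorm_pos_le)
    then show ?thesis
      using A_norm_le_norm[of "(R ^^ n) x"] by (simp add: p_def C_def mult_ac)
  qed
  \<comment> \<open>If the claim fails then \<open>q > 1\<close>, yet \<open>lower\<close> and
    \<open>upper\<close> bound all the powers \<open>q ^ (2 ^ n)\<close> by the fixed constant
    \<open>C\<close>.\<close>
  define q where "q = p 1 / K"
  have q: "q > 1" using \<open>\<not> A_norm A (R x) \<le> K\<close> K by (simp add: q_def p_def)
  then obtain n where "C < q ^ n" using real_arch_pow by blast
  also have "q ^ n \<le> q ^ (2 ^ n)" using q by (intro power_increasing) (auto intro: less_imp_le)
  also have "\<dots> \<le> C"
    using order_trans[OF lower upper, of n] K by (simp add: q_def power_divide field_simps)
  finally show False by simp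
qed

text \<open>The product of \<open>T\<close> with an \<open>A\<close>-adjoint is
  \<open>A\<close>-selfadjoint, so its ordinary norm bound carries over to the seminorm.\<close>

lemma A_norm_adjoint_comp_bounded:
  assumes T: "bounded_clinear T" and T': "bounded_clinear T'"
    and adj: "\<And>x y. A_inner A (T x) y = A_inner A x (T' y)"
  obtains K where "\<And>x. A_norm A x = 1 \<Longrightarrow> A_norm A (T' (T x)) \<le> K"
proof -
  have R: "bounded_clinear (T' \<circ> T)" by (rule bounded_clinear_compose[OF T' T])
  have adj': "A_inner A (T' x) y = A_inner A x (T y)" for x y
    using adj[of y x] by (metis A_inner_commute)
  have sa: "A_inner A ((T' \<circ> T) x) y = A_inner A x ((T' \<circ> T) y)" for x y
    by (simp add: adj adj')
  obtain K where "K > 0" "\<And>x. norm ((T' \<circ> T) x) \<le> norm x * K"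
    using R bounded_linear.pos_bounded unfolding bounded_clinear_def by blast
  then have "A_norm A ((T' \<circ> T) x) \<le> K" if "A_norm A x = 1" for x
    using A_norm_selfadjoint_le[OF R sa _ _ that] by (simp add: mult.commute)
  then show thesis by (intro that) simp
qed

section \<open>Existence and uniqueness of the distinguished \<open>A\<close>-adjoint\<close>

lemma A_inj_closure_range:
  assumes "A x = 0" "x \<in> closure (range A)"
  shows "x = 0"
proof -
  \<comment> \<open>By symmetry of \<open>A\<close> a kernel vector is orthogonal to
    \<open>range A\<close>, hence to its closure, hence to itself.\<close>
  have "closed {u. inner x u = 0}"
    by (intro closed_Collect_eq continuous_intros)
  moreover have "inner x (A z) = 0" for z
    using A_symmetric[of x z] assms(1) Re_cinner[of 0 z] Re_cinner[of x "A z"] by simp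
  then have "range A \<subseteq> {u. inner x u = 0}" by auto
  ultimately have "closure (range A) \<subseteq> {u. inner x u = 0}" by (rule closure_minimal[rotated])
  then show ?thesis using assms(2) by auto
qed

lemma subspace_closure_range: "subspace (closure (range A))"
proof (intro subspace_closure linear_subspace_image subspace_UNIV)
  show "linear A"
    using A_bounded_clinear by (simp add: bounded_clinear_def bounded_linear.axioms(1))
qed

text \<open>Project \<open>w\<close> onto the closed range: the remainder is orthogonal to
  \<open>range A\<close>, so symmetry puts it in the kernel of \<open>A\<close>.\<close>

lemma ex_closure_range_eq:
  "\<exists>p\<in>closure (range A). A p = A w"
proof -
  obtain p where p: "p \<in> closure (range A)"
    and orth: "\<And>v. v \<in> closure (range A) \<Longrightarrow> inner (w - p) v = 0"
    using closed_subspace_projection[OF subspace_closure_range closed_closure] by blast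
  have "inner (A (w - p)) z = 0" for z
    using orth[of "A z"] A_symmetric[of "w - p" z] closure_subset[of "range A"]
    by (metis Re_cinner rangeI subsetD)
  then have "A (w - p) = 0" using inner_eq_zero_iff by blast
  then have "A p = A w" by (simp add: bounded_clinear_diff[OF A_bounded_clinear])
  with p show ?thesis by blast
qed

text \<open>Choose for \<open>X x\<close> the solution of \<open>A (X x) = cadjoint T (A x)\<close>
  in the closed range. Injectivity of \<open>A\<close> there makes \<open>X\<close> linear, and weak
  continuity against \<open>range A\<close> makes it bounded.\<close>

lemma A_sharp_exists:
  assumes "T \<in> B_A A"
  obtains X where "bounded_clinear X" "A \<circ> X = cadjoint T \<circ> A" "range X \<subseteq> closure (range A)"
proof -
  have T: "bounded_clinear T" and ran: "range (cadjoint T \<circ> A) \<subseteq> range A"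
    using assms by (simp_all add: B_A_def)
  note adj = bounded_clinear_cadjoint[OF T]
  have "\<exists>y. y \<in> closure (range A) \<and> A y = cadjoint T (A x)" for x
  proof -
    obtain w where "cadjoint T (A x) = A w" using ran by fastforce
    then show ?thesis using ex_closure_range_eq[of w] by metis
  qed
  then obtain X where XV: "\<And>x. X x \<in> closure (range A)"
    and X: "\<And>x. A (X x) = cadjoint T (A x)" by metis
  have eqI: "u = v" if "u \<in> closure (range A)" "v \<in> closure (range A)" "A u = A v" for u v
    using A_inj_closure_range[of "u - v"] that subspace_closure_range
    by (simp add: subspace_diff bounded_clinear_diff[OF A_bounded_clinear])
  \<comment> \<open>\<open>subspace\<close> gives invariance under real scalars only; complex ones
    preserve \<open>range A\<close> and act continuously.\<close>
  have scaleC_closure: "c *\<^sub>C u \<in> closure (range A)" if u: "u \<in> closure (range A)" for c u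
  proof -
    have "(\<lambda>u. c *\<^sub>C u) ` closure (range A) \<subseteq> closure (range A)"
    proof (rule image_closure_subset)
      show "continuous_on (closure (range A)) (\<lambda>u. c *\<^sub>C u)"
        by (rule linear_continuous_on[OF bounded_linear_scaleC])
      have "c *\<^sub>C A z \<in> range A" for z
        by (metis bounded_clinear_scaleC[OF A_bounded_clinear] rangeI)
      then show "(\<lambda>u. c *\<^sub>C u) ` range A \<subseteq> closure (range A)"
        using closure_subset by blast
    qed simp
    then show ?thesis using u by blast
  qed
  have linear: "linear X"
    by (rule linearI; rule eqI)
      (simp_all add: XV X subspace_add subspace_mul subspace_closure_range
        bounded_clinear_add[OF A_bounded_clinear] bounded_clinear_add[OF adj]
        bounded_clinear_scaleR[OF A_bounded_clinear] bounded_clinear_scaleR[OF adj])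
  have "bounded_linear X"
  proof (rule bounded_linear_if_weakly_continuous[OF linear XV])
    fix d assume "d \<in> range A"
    then obtain z where d: "d = A z" by blast
    \<comment> \<open>Tested against \<open>A z\<close>, the possibly unbounded \<open>X\<close>
      disappears and a continuous functional of \<open>x\<close> remains.\<close>
    have "inner (X x) d = inner x (A (T z))" for x
    proof -
      have "cinner (X x) (A z) = cinner (cadjoint T (A x)) z" by (simp add: X flip: A_symmetric)
      also have "\<dots> = cinner (A x) (T z)"
        using cinner_cadjoint[OF T, of z "A x"] by (metis cinner_commute)
      also have "\<dots> = cinner x (A (T z))" by (rule A_symmetric)
      finally show ?thesis by (simp add: d flip: Re_cinner)
    qed
    then show "continuous_on UNIV (\<lambda>x. inner (X x) d)" by (simp add: continuous_on_inner)
  qed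
  moreover have "X (c *\<^sub>C x) = c *\<^sub>C X x" for c x
    by (rule eqI)
      (simp_all add: XV scaleC_closure X bounded_clinear_scaleC[OF A_bounded_clinear]
        bounded_clinear_scaleC[OF adj])
  ultimately have "bounded_clinear X" by (simp add: bounded_clinear_def)
  then show thesis using XV X by (intro that) auto
qed

text \<open>Two candidates differ at each point by a vector of the closed range that
  \<open>A\<close> kills, so the description in \<open>A_sharp\<close> denotes a unique
  operator.\<close>

lemma
  assumes "T \<in> B_A A"
  shows bounded_clinear_A_sharp: "bounded_clinear (A_sharp A T)"
    and A_inner_A_sharp: "A_inner A (T x) y = A_inner A x (A_sharp A T y)"
proof -
  let ?P = "\<lambda>X. bounded_clinear X \<and> A \<circ> X = cadjoint T \<circ> A \<and> range X \<subseteq> closure (range A)"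
  have "\<exists>!X. ?P X"
  proof (rule ex_ex1I)
    show "\<exists>X. ?P X" using A_sharp_exists[OF assms] by metis
    show "X = Y" if X: "?P X" and Y: "?P Y" for X Y
    proof
      fix x
      have "A (X x) = A (Y x)" using X Y by (metis comp_apply)
      then have "A (X x - Y x) = 0" by (simp add: bounded_clinear_diff[OF A_bounded_clinear])
      moreover have "X x - Y x \<in> closure (range A)"
        using X Y subspace_closure_range by (blast intro: subspace_diff)
      ultimately show "X x = Y x" using A_inj_closure_range[of "X x - Y x"] by simp
    qed
  qed
  then have P: "?P (A_sharp A T)" unfolding A_sharp_def by (rule theI')
  then show "bounded_clinear (A_sharp A T)" by blast
  have T: "bounded_clinear T" using assms by (simp add: B_A_def)
  have "A (A_sharp A T y) = cadjoint T (A y)" using P by (metis comp_apply)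
  then show "A_inner A (T x) y = A_inner A x (A_sharp A T y)"
    by (simp add: A_inner_def A_symmetric cinner_cadjoint[OF T])
qed

end

section \<open>The bound for the Euclidean radius\<close>

theorem theorem2p5:
  fixes A T S :: "'a::complex_hilbert_space \<Rightarrow> 'a"
  assumes "positive_op A" and "A \<noteq> (\<lambda>x. 0)"
    and "T \<in> B_A A" and "S \<in> B_A A"
  shows "A_euclidean_radius A T S \<le>
    sqrt (max (A_numradius A T) (A_numradius A S) *
      sqrt (A_opnorm A (\<lambda>x. A_sharp A T (T x) + A_sharp A S (S x))
            + 2 * A_numradius A (A_sharp A S \<circ> T)))"
proof -
  interpret positive_operator A by unfold_locales (rule assms)
  note T = \<open>T \<in> B_A A\<close> and S = \<open>S \<in> B_A A\<close>
  let ?R = "\<lambda>x. A_sharp A T (T x) + A_sharp A S (S x)"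
  let ?U = "{x. A_norm A x = 1}"
  have "bounded_clinear T" "bounded_clinear S" using T S by (simp_all add: B_A_def)
  then obtain K L where K: "\<And>x. A_norm A x = 1 \<Longrightarrow> A_norm A (A_sharp A T (T x)) \<le> K"
    and L: "\<And>x. A_norm A x = 1 \<Longrightarrow> A_norm A (A_sharp A S (S x)) \<le> L"
    using A_norm_adjoint_comp_bounded[OF _ bounded_clinear_A_sharp A_inner_A_sharp] T S by metis
  have TT: "A_inner A x (A_sharp A T (T x)) = of_real ((A_norm A (T x))\<^sup>2)" for x
    by (simp flip: A_inner_A_sharp[OF T] add: A_inner_self)
  have SS: "A_inner A x (A_sharp A S (S x)) = of_real ((A_norm A (S x))\<^sup>2)" for x
    by (simp flip: A_inner_A_sharp[OF S] add: A_inner_self)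
  have ST: "cmod (A_inner A ((A_sharp A S \<circ> T) x) x) = cmod (A_inner A (S x) (T x))" for x
    by (metis A_inner_A_sharp[OF S] A_inner_commute comp_apply complex_mod_cnj)
  \<comment> \<open>The squared seminorm of \<open>T x\<close> is the semi-inner product of
    \<open>x\<close> with \<open>A_sharp A T (T x)\<close>, so Cauchy-Schwarz bounds it by
    \<open>K\<close>; likewise for \<open>S\<close> and \<open>L\<close>.\<close>
  have T_le: "A_norm A (T x) \<le> sqrt K" and S_le: "A_norm A (S x) \<le> sqrt L"
    if x: "A_norm A x = 1" for x
    using Re_A_inner_le[of x "A_sharp A T (T x)"] Re_A_inner_le[of x "A_sharp A S (S x)"]
      K[OF x] L[OF x] x by (auto simp: TT SS intro!: real_le_rsqrt)
  \<comment> \<open>Boundedness of the four families lets \<open>cSUP_upper\<close> compare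
    pointwise values with the real suprema.\<close>
  have bdd_T: "bdd_above ((\<lambda>x. cmod (A_inner A (T x) x)) ` ?U)"
    using A_Cauchy_Schwarz T_le by (intro bdd_aboveI2[where M = "sqrt K"]) (force intro: order_trans)
  have bdd_S: "bdd_above ((\<lambda>x. cmod (A_inner A (S x) x)) ` ?U)"
    using A_Cauchy_Schwarz S_le by (intro bdd_aboveI2[where M = "sqrt L"]) (force intro: order_trans)
  have bdd_R: "bdd_above ((\<lambda>x. A_norm A (?R x)) ` ?U)"
  proof (rule bdd_aboveI2)
    show "A_norm A (?R x) \<le> K + L" if "x \<in> ?U" for x
      using A_norm_triangle[of "A_sharp A T (T x)" "A_sharp A S (S x)"] K[of x] L[of x] that
      by simp
  qed
  have bdd_ST: "bdd_above ((\<lambda>x. cmod (A_inner A ((A_sharp A S \<circ> T) x) x)) ` ?U)"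
  proof (rule bdd_aboveI2)
    fix x assume "x \<in> ?U"
    then have "A_norm A (S x) * A_norm A (T x) \<le> sqrt L * sqrt K"
      using S_le[of x] T_le[of x] order_trans[OF A_norm_nonneg S_le[of x]]
      by (intro mult_mono A_norm_nonneg) simp_all
    then show "cmod (A_inner A ((A_sharp A S \<circ> T) x) x) \<le> sqrt L * sqrt K"
      using A_Cauchy_Schwarz[of "S x" "T x"] unfolding ST by linarith
  qed
  define M where "M = max (A_numradius A T) (A_numradius A S)"
  define Q where "Q = A_opnorm A ?R + 2 * A_numradius A (A_sharp A S \<circ> T)"
  have "sqrt ((cmod (A_inner A (T x) x))\<^sup>2 + (cmod (A_inner A (S x) x))\<^sup>2) \<le> sqrt (M * sqrt Q)"
    if x: "A_norm A x = 1" for x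
  proof -
    define a where "a = A_inner A (T x) x"
    define b where "b = A_inner A (S x) x"
    define y where "y = cnj a *\<^sub>C T x + cnj b *\<^sub>C S x"
    have a: "cmod a \<le> M"
      unfolding a_def M_def A_numradius_def
      by (intro max.coboundedI1 cSUP_upper bdd_T) (simp add: x)
    have b: "cmod b \<le> M"
      unfolding b_def M_def A_numradius_def
      by (intro max.coboundedI2 cSUP_upper bdd_S) (simp add: x)
    have M: "M \<ge> 0" using a norm_ge_zero order_trans by blast
    have "A_inner A y x = of_real ((cmod a)\<^sup>2 + (cmod b)\<^sup>2)"
      unfolding of_real_add complex_norm_square
      by (simp add: y_def A_inner_add_left A_inner_scaleC_left mult.commute flip: a_def b_def)
    then have "(cmod a)\<^sup>2 + (cmod b)\<^sup>2 \<le> A_norm A y"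
      using Re_A_inner_le[of y x] x by simp
    moreover have "A_norm A y \<le> M * sqrt Q"
    proof -
      let ?c = "A_inner A (S x) (T x)"
      \<comment> \<open>The two mixed terms are conjugate to each other, so they add up to twice a
        real part.\<close>
      have "A_inner A y y = of_real ((cmod a)\<^sup>2 * (A_norm A (T x))\<^sup>2)
          + of_real ((cmod b)\<^sup>2 * (A_norm A (S x))\<^sup>2) + (a * cnj b * ?c + cnj (a * cnj b * ?c))"
        using A_inner_commute[of "T x" "S x"]
        unfolding of_real_mult complex_norm_square[of a] complex_norm_square[of b]
        by (simp add: y_def A_inner_add_left A_inner_add_right A_inner_scaleC_left
            A_inner_scaleC_right A_inner_self[of "T x"] A_inner_self[of "S x"] algebra_simps)
      then have "(A_norm A y)\<^sup>2 = (cmod a)\<^sup>2 * (A_norm A (T x))\<^sup>2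
          + (cmod b)\<^sup>2 * (A_norm A (S x))\<^sup>2 + 2 * Re (a * cnj b * ?c)"
        by (simp add: A_norm_power2 algebra_simps)
      also have "\<dots> \<le> M\<^sup>2 * (A_norm A (T x))\<^sup>2 + M\<^sup>2 * (A_norm A (S x))\<^sup>2 + 2 * (M\<^sup>2 * cmod ?c)"
      proof (intro add_mono mult_right_mono mult_left_mono power_mono a b)
        have "Re (a * cnj b * ?c) \<le> cmod a * cmod b * cmod ?c"
          using complex_Re_le_cmod[of "a * cnj b * ?c"] by (simp add: norm_mult)
        also have "\<dots> \<le> M * M * cmod ?c"
          by (intro mult_right_mono mult_mono a b M) auto
        finally show "Re (a * cnj b * ?c) \<le> M\<^sup>2 * cmod ?c" by (simp add: power2_eq_square)
      qed auto
      also have "\<dots> = M\<^sup>2 * (((A_norm A (T x))\<^sup>2 + (A_norm A (S x))\<^sup>2) + 2 * cmod ?c)"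
        by (simp add: algebra_simps)
      also have "\<dots> \<le> M\<^sup>2 * Q"
      proof (intro mult_left_mono)
        \<comment> \<open>Both squares combine into one semi-inner product of \<open>x\<close> with
          \<open>?R x\<close>, so a single operator seminorm controls their sum.\<close>
        have "(A_norm A (T x))\<^sup>2 + (A_norm A (S x))\<^sup>2 = Re (A_inner A x (?R x))"
          by (simp add: A_inner_add_right TT SS)
        also have "\<dots> \<le> A_norm A (?R x)" using Re_A_inner_le[of x "?R x"] x by simp
        also have "\<dots> \<le> A_opnorm A ?R"
          unfolding A_opnorm_def by (intro cSUP_upper bdd_R) (simp add: x)
        finally have "(A_norm A (T x))\<^sup>2 + (A_norm A (S x))\<^sup>2 \<le> A_opnorm A ?R" .
        moreover have "cmod ?c \<le> A_numradius A (A_sharp A S \<circ> T)"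
          unfolding A_numradius_def ST[symmetric] by (intro cSUP_upper bdd_ST) (simp add: x)
        ultimately show "((A_norm A (T x))\<^sup>2 + (A_norm A (S x))\<^sup>2) + 2 * cmod ?c \<le> Q"
          unfolding Q_def by simp
      qed simp
      finally have "A_norm A y \<le> sqrt (M\<^sup>2 * Q)" by (rule real_le_rsqrt)
      then show ?thesis using M by (simp add: real_sqrt_mult)
    qed
    ultimately show ?thesis unfolding a_def b_def by simp
  qed
  then have "A_euclidean_radius A T S \<le> sqrt (M * sqrt Q)"
    unfolding A_euclidean_radius_def using ex_A_norm_eq_1[OF assms(2)]
    by (intro cSUP_least) auto
  then show ?thesis by (simp only: M_def Q_def)
qed

end
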